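(* Consider a mapping $F:\mathbb{R}^n\times\mathbb{R}^m\rightrightarrows\mathbb{R}^l$ and let $S(x):=\{y\in\mathbb{R}^m : 0\in F(x,y)\}$, $x\in\mathbb{R}^n$. Assume that we are given an open set $\Omega\subset\mathbb{R}^n$ and a continuous mapping $\sigma:\Omega\to\mathbb{R}^m$ such that for every $x\in\Omega$: $F$ is semismooth$^*$ at $(x,\sigma(x),0)$, the qualification condition $$(x^*,0)\in D^*F(x,\sigma(x),0)(z^* )\ \Rightarrow\ z^*=0,\ x^*=0$$ holds, and there exists a neighborhood $U\times V$ of $(x,\sigma(x))$ such that $\mathrm{gph}\,S\cap(U\times V)=\mathrm{gph}\,\sigma\cap(U\times V)$. Define $\Sigma(x,y)(y^* ):=\{x^* : \exists z^*\in\mathbb{R}^l\text{ with }(x^*,-y^* )\in D^*F(x,y,0)(z^* )\}$. Then $\sigma$ is semismooth on $\Omega$ with respect to the mapping $\Psi:\mathbb{R}^n\rightrightarrows\mathbb{R}^{m\times n}$ which assigns to each $x\in\Omega$ the set of all $m\times n$ matrices whose $i$-th row, $i=1,\ldots,m$, belongs to $\{{u^*}^T : u^*\in\Sigma(x,\sigma(x))(e_i)\}$, where $e_i$ is the $i$-th unit vector in $\mathbb{R}^m$. Further, for every function $\varphi:D\to\mathbb{R}$, where $D$ is an open subset of $\mathbb{R}^n\times\mathbb{R}^m$ containing $\mathrm{gph}\,\sigma$, which is semismooth on $\mathrm{gph}\,\sigma$ with respect to some mapping $\Phi:\mathbb{R}^n\times\mathbb{R}^m\rightrightarrows\mathbb{R}^{1\times(n+m)}$,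 the mapping $\theta:\Omega\to\mathbb{R}$ given by $\theta(x)=\varphi(x,\sigma(x))$ is semismooth on $\Omega$ with respect to the mapping $\Theta:\mathbb{R}^n\rightrightarrows\mathbb{R}^{1\times n}$ given by $$\Theta(x):=\{g_x^T+{x^*}^T : x^*\in\Sigma(x,\sigma(x))(g_y),\ (g_x^T,g_y^T)\in\Phi(x,\sigma(x))\},\quad x\in\mathrm{dom}\,\Theta:=\Omega.$$
   Context: For a multifunction $G:\mathbb{R}^p\rightrightarrows\mathbb{R}^q$: $\mathrm{gph}\,G=\{(x,y) : y\in G(x)\}$, $\mathrm{dom}\,G=\{x : G(x)\neq\emptyset\}$. For a set $C\subset\mathbb{R}^s$ and $z\in C$: tangent cone $T_C(z)=\{w : \exists t_k\downarrow0,\ w_k\to w,\ z+t_kw_k\in C\}$; regular normal cone $\widehat N_C(z)=(T_C(z))^\circ$ (negative polar cone); limiting normal cone $N_C(\bar z)=\{z^* : \exists z_k\to\bar z,\ z_k\in C,\ z_k^*\in\widehat N_C(z_k),\ z_k^*\to z^*\}$. The limiting coderivative of $G$ at $(\bar x,\bar y)\in\mathrm{gph}\,G$ is the multifunction $D^*G(\bar x,\bar y):\mathbb{R}^q\rightrightarrows\mathbb{R}^p$ with $x^*\in D^*G(\bar x,\bar y)(y^* )$ iff $(x^*,-y^* )\in N_{\mathrm{gph}\,G}(\bar x,\bar y)$. For $F:\mathbb{R}^n\times\mathbb{R}^m\rightrightarrows\mathbb{R}^l$, $D^*F(x,y,z)$ maps $\mathbb{R}^l$ into subsets of $\mathbb{R}^n\times\mathbb{R}^m$.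 $G$ is semismooth$^*$ at $(\bar x,\bar y)\in\mathrm{gph}\,G$ if for every $\epsilon>0$ there is $\delta>0$ such that $|\langle x^*,x-\bar x\rangle-\langle y^*,y-\bar y\rangle|\le\epsilon\|(x,y)-(\bar x,\bar y)\|\,\|(y^*,x^* )\|$ for all $(x,y)\in\mathrm{gph}\,G$ with $\|(x,y)-(\bar x,\bar y)\|\le\delta$ and all $(y^*,x^* )\in\mathrm{gph}\,D^*G(x,y)$. A mapping $f:\Omega'\to\mathbb{R}^q$ ($\Omega'\subset\mathbb{R}^p$ open) is semismooth with respect to a multifunction $\Psi:\mathbb{R}^p\rightrightarrows\mathbb{R}^{q\times p}$ at $\bar u\in\Omega'$ if $\mathrm{dom}\,\Psi$ is a neighborhood of $\bar u$, $\Psi$ is locally bounded at $\bar u$ (its values are uniformly bounded on a neighborhood of $\bar u$), and $\lim_{u\to\bar u,\,u\in\Omega',\,u\ne\bar u}\sup\{\|f(u)-f(\bar u)-A(u-\bar u)\| : A\in\Psi(u)\}/\|u-\bar u\|=0$. It is semismooth on a subset of $\Omega'$ with respect to $\Psi$ if this holds at each point of the subset. Here $g_x\in\mathbb{R}^n$, $g_y\in\mathbb{R}^m$ are column vectors, and elements of $\Phi$, $\Theta$ are row vectors.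
   Formalization: Adds the assumption that gph F is locally closed at (x,σ(x),0) for every x in Ω; without it the claim fails, e.g. for F(x,y)={z : z≠0 or y=0}, σ=0, where all normal cones are {0} and Σ(x,σ(x))(1) is empty. *)

theory Defs
  imports "HOL-Analysis.Analysis"
begin

section \<open>Multifunctions\<close>

type_synonym ('a, 'b) multifunction = "'a \<Rightarrow> 'b set"

definition gph :: "('a, 'b) multifunction \<Rightarrow> ('a \<times> 'b) set" where
  "gph G = {(x, y). y \<in> G x}"

definition mdom :: "('a, 'b) multifunction \<Rightarrow> 'a set" where
  "mdom G = {x. G x \<noteq> {}}"

text \<open>A single-valued map given on a set \<open>\<Omega>\<close> is modelled by a total function whose values
  outside \<open>\<Omega>\<close> are irrelevant; its graph is taken over \<open>\<Omega>\<close> only.\<close>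

definition gph_on :: "'a set \<Rightarrow> ('a \<Rightarrow> 'b) \<Rightarrow> ('a \<times> 'b) set" where
  "gph_on \<Omega> f = (\<lambda>x. (x, f x)) ` \<Omega>"


section \<open>Tangent and normal cones, coderivative\<close>

text \<open>\<open>t\<^sub>k \<down> 0\<close> means \<open>t\<^sub>k > 0\<close> and \<open>t\<^sub>k \<rightarrow> 0\<close>; passing to a subsequence, one
  may equivalently require monotonicity.\<close>

definition tangent_cone :: "'a::euclidean_space set \<Rightarrow> 'a \<Rightarrow> 'a set" where
  "tangent_cone C z =
     {w. \<exists>(t :: nat \<Rightarrow> real) (v :: nat \<Rightarrow> 'a).
           (\<forall>k. t k > 0) \<and> t \<longlonglongrightarrow> 0 \<and> v \<longlonglongrightarrow> w \<and> (\<forall>k. z + t k *\<^sub>R v k \<in> C)}"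

definition polar_cone :: "'a::euclidean_space set \<Rightarrow> 'a set" where
  "polar_cone K = {v. \<forall>w\<in>K. v \<bullet> w \<le> 0}"

definition regular_normal_cone :: "'a::euclidean_space set \<Rightarrow> 'a \<Rightarrow> 'a set" where
  "regular_normal_cone C z = polar_cone (tangent_cone C z)"

text \<open>The cones are meaningful for base points in \<open>C\<close>; the limiting normal cone is empty
  elsewhere.\<close>

definition limiting_normal_cone :: "'a::euclidean_space set \<Rightarrow> 'a \<Rightarrow> 'a set" where
  "limiting_normal_cone C z =
     {zs. z \<in> C \<and>
          (\<exists>(u :: nat \<Rightarrow> 'a) (us :: nat \<Rightarrow> 'a).
             u \<longlonglongrightarrow> z \<and> (\<forall>k. u k \<in> C) \<and>
             (\<forall>k. us k \<in> regular_normal_cone C (u k)) \<and> us \<longlonglongrightarrow> zs)}"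

definition coderivative ::
  "('a::euclidean_space, 'b::euclidean_space) multifunction \<Rightarrow> 'a \<Rightarrow> 'b \<Rightarrow> ('b, 'a) multifunction"
  where
  "coderivative G x y ys = {xs. (xs, - ys) \<in> limiting_normal_cone (gph G) (x, y)}"

text \<open>Product types carry the Euclidean norm \<open>sqrt (\<parallel>x\<parallel>\<^sup>2 + \<parallel>y\<parallel>\<^sup>2)\<close>.\<close>

definition semismooth_star ::
  "('a::euclidean_space, 'b::euclidean_space) multifunction \<Rightarrow> 'a \<Rightarrow> 'b \<Rightarrow> bool" where
  "semismooth_star G xb yb \<longleftrightarrow>
     (xb, yb) \<in> gph G \<and>
     (\<forall>\<epsilon>>0. \<exists>\<delta>>0. \<forall>(x, y)\<in>gph G. norm ((x, y) - (xb, yb)) \<le> \<delta> \<longrightarrow>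
        (\<forall>(ys, xs)\<in>gph (coderivative G x y).
           \<bar>xs \<bullet> (x - xb) - ys \<bullet> (y - yb)\<bar> \<le> \<epsilon> * norm ((x, y) - (xb, yb)) * norm (ys, xs)))"

text \<open>The coderivative calculus for implicitly defined multifunctions needs local closedness of
  graphs. For example, \<open>F (x, y) = {z. z \<noteq> 0 \<or> y = 0}\<close> (scalar \<open>x\<close>, \<open>y\<close>, \<open>z\<close>) with
  \<open>\<sigma> = 0\<close> has only trivial normals, hence satisfies the qualification condition and is
  semismooth*, but the coderivative-based \<open>\<Sigma>(x,\<sigma> x)(1)\<close> is empty.\<close>

definition locally_closed_at :: "'a::euclidean_space set \<Rightarrow> 'a \<Rightarrow> bool" where
  "locally_closed_at C z \<longleftrightarrow> (\<exists>r>0. closed (C \<inter> cball z r))"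


section \<open>Semismoothness with respect to a multifunction\<close>

text \<open>The argument \<open>act\<close> is the product of a matrix with a vector. It is \<open>(*v)\<close> for matrices in
  \<^typ>\<open>real ^ 'n ^ 'm\<close>, and the inner product for a row vector \<open>g\<^sup>T\<close>, which is represented by the
  vector \<open>g\<close> itself (for \<open>1 \<times> (n + m)\<close> row vectors, by the pair of its two blocks). The choice of
  the norm on matrices does not matter for local boundedness.

  The real supremum below is the true supremum: by the domain and local boundedness
  requirements \<open>\<Psi> u\<close> is nonempty and bounded for all \<open>u\<close> near \<open>ub\<close>.\<close>

definition semismooth_wrt_at ::
  "('l::real_normed_vector \<Rightarrow> 'a \<Rightarrow> 'b) \<Rightarrow> 'a::euclidean_space set \<Rightarrow> ('a \<Rightarrow> 'b::euclidean_space)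
     \<Rightarrow> ('a, 'l) multifunction \<Rightarrow> 'a \<Rightarrow> bool" where
  "semismooth_wrt_at act \<Omega> f \<Psi> ub \<longleftrightarrow>
     open \<Omega> \<and> ub \<in> \<Omega> \<and>
     ub \<in> interior (mdom \<Psi>) \<and>
     (\<exists>N. open N \<and> ub \<in> N \<and> bounded (\<Union>u\<in>N. \<Psi> u)) \<and>
     ((\<lambda>u. (SUP A\<in>\<Psi> u. norm (f u - f ub - act A (u - ub))) / norm (u - ub)) \<longlongrightarrow> 0)
       (at ub within \<Omega>)"

definition semismooth_matrix_on ::
  "(real ^ 'n) set \<Rightarrow> (real ^ 'n \<Rightarrow> real ^ 'm) \<Rightarrow> (real ^ 'n, real ^ 'n ^ 'm) multifunction
     \<Rightarrow> (real ^ 'n) set \<Rightarrow> bool" where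
  "semismooth_matrix_on \<Omega> f \<Psi> T \<longleftrightarrow> (\<forall>u\<in>T. semismooth_wrt_at (*v) \<Omega> f \<Psi> u)"

definition semismooth_row_on ::
  "'a::euclidean_space set \<Rightarrow> ('a \<Rightarrow> real) \<Rightarrow> ('a, 'a) multifunction \<Rightarrow> 'a set \<Rightarrow> bool" where
  "semismooth_row_on \<Omega> f \<Psi> T \<longleftrightarrow> (\<forall>u\<in>T. semismooth_wrt_at (\<bullet>) \<Omega> f \<Psi> u)"


section \<open>Implicit multifunctions\<close>

definition solution_map ::
  "((real ^ 'n) \<times> (real ^ 'm), real ^ 'l) multifunction \<Rightarrow> (real ^ 'n, real ^ 'm) multifunction"
  where
  "solution_map F x = {y. 0 \<in> F (x, y)}"

text \<open>The map \<open>\<Sigma>(x,y)\<close>.\<close>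

definition implicit_coderivative ::
  "((real ^ 'n) \<times> (real ^ 'm), real ^ 'l) multifunction
     \<Rightarrow> real ^ 'n \<Rightarrow> real ^ 'm \<Rightarrow> (real ^ 'm, real ^ 'n) multifunction" where
  "implicit_coderivative F x y ys = {xs. \<exists>zs. (xs, - ys) \<in> coderivative F (x, y) 0 zs}"

text \<open>\<open>\<Psi>\<close> and \<open>\<Theta>\<close> have no values outside \<open>\<Omega>\<close>. That \<open>\<Theta>\<close> is nonempty on all of \<open>\<Omega>\<close> is
  part of its semismoothness on \<open>\<Omega>\<close>.\<close>

definition implicit_Psi ::
  "((real ^ 'n) \<times> (real ^ 'm), real ^ 'l) multifunction \<Rightarrow> (real ^ 'n) set
     \<Rightarrow> (real ^ 'n \<Rightarrow> real ^ 'm) \<Rightarrow> (real ^ 'n, real ^ 'n ^ 'm) multifunction" where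
  "implicit_Psi F \<Omega> \<sigma> x =
     (if x \<in> \<Omega> then {A. \<forall>i. row i A \<in> implicit_coderivative F x (\<sigma> x) (axis i 1)} else {})"

definition implicit_Theta ::
  "((real ^ 'n) \<times> (real ^ 'm), real ^ 'l) multifunction \<Rightarrow> (real ^ 'n) set
     \<Rightarrow> (real ^ 'n \<Rightarrow> real ^ 'm)
     \<Rightarrow> ((real ^ 'n) \<times> (real ^ 'm), (real ^ 'n) \<times> (real ^ 'm)) multifunction
     \<Rightarrow> (real ^ 'n, real ^ 'n) multifunction" where
  "implicit_Theta F \<Omega> \<sigma> \<Phi> x =
     (if x \<in> \<Omega>
      then {gx + xs | gx gy xs.
              (gx, gy) \<in> \<Phi> (x, \<sigma> x) \<and> xs \<in> implicit_coderivative F x (\<sigma> x) gy}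
      else {})"

end

theory Submission
  imports Defs
begin

text \<open>\<open>\<Sigma>\<close> has nonempty values: minimising \<open>y\<^sup>* \<bullet> y + k * ((norm (x - x0))\<^sup>2 + (norm z)\<^sup>2)\<close> over
  \<open>gph F\<close> near \<open>(x0, \<sigma> x0, 0)\<close> gives regular normals with \<open>y\<close>-component \<open>- y\<^sup>*\<close> at points that
  converge to \<open>(x0, \<sigma> x0, 0)\<close> as \<open>k\<close> grows, since \<open>\<sigma> x0\<close> is an isolated point of \<open>S x0\<close>. By the
  qualification condition and a compactness argument, all normals near \<open>(x0, \<sigma> x0, 0)\<close> are bounded
  by a multiple of their \<open>y\<close>-component, so these normals have a limit point. With the same bound,
  semismoothness* of \<open>F\<close> yields \<open>x\<^sup>* \<bullet> (x - x0) - y\<^sup>* \<bullet> (\<sigma> x - \<sigma> x0) = o(norm (x - x0))\<close> for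
  \<open>x\<^sup>* \<in> \<Sigma> (x, \<sigma> x) y\<^sup>*\<close>, once \<open>norm (\<sigma> x - \<sigma> x0) = O(norm (x - x0))\<close> is known; the latter
  follows by taking \<open>y\<^sup>* = \<sigma> x - \<sigma> x0\<close>.\<close>

section \<open>Regular and limiting normals: production, approximation, closed graph,
  scaling\<close>

lemma LIMSEQ_dist_less_inverse:
  fixes u :: "nat \<Rightarrow> 'a::metric_space"
  assumes "\<And>k. dist (u k) z < inverse (real (Suc k))"
  shows "u \<longlonglongrightarrow> z"
proof (rule metric_tendsto_imp_tendsto[OF LIMSEQ_inverse_real_of_nat])
  show "\<forall>\<^sub>F k in sequentially. dist (u k) z \<le> dist (inverse (real (Suc k))) 0"
    using assms by (intro always_eventually allI) (simp add: less_imp_le del: of_nat_Suc)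
qed

text \<open>Along a tangent sequence, dividing the inequality by \<open>t k\<close> leaves a
  right-hand side of order \<open>t k\<close>, which vanishes in the limit. Minimisers of a linear
  function plus a quadratic penalty satisfy a one-sided bound of this kind, which is how regular
  normals are produced below.\<close>

lemma proximal_normal_in_regular_normal_cone:
  fixes C :: "'a::euclidean_space set"
  assumes "\<delta> > 0" and le: "\<And>q. q \<in> C \<Longrightarrow> dist q p < \<delta> \<Longrightarrow> n \<bullet> (q - p) \<le> M * (norm (q - p))\<^sup>2"
  shows "n \<in> regular_normal_cone C p"
  unfolding regular_normal_cone_def polar_cone_def
proof (intro CollectI ballI)
  fix w assume "w \<in> tangent_cone C p"
  then obtain t v where t: "\<And>k. t k > 0" "t \<longlonglongrightarrow> 0" and v: "v \<longlonglongrightarrow> w"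
    and C: "\<And>k. p + t k *\<^sub>R v k \<in> C"
    unfolding tangent_cone_def by blast
  have "(\<lambda>k. t k *\<^sub>R v k) \<longlonglongrightarrow> 0 *\<^sub>R w"
    by (intro tendsto_intros t v)
  then have "\<forall>\<^sub>F k in sequentially. dist (t k *\<^sub>R v k) 0 < \<delta>"
    using \<open>\<delta> > 0\<close> tendstoD by fastforce
  then have ev: "\<forall>\<^sub>F k in sequentially. n \<bullet> v k \<le> M * t k * (norm (v k))\<^sup>2"
  proof eventually_elim
    case (elim k)
    then have "n \<bullet> (t k *\<^sub>R v k) \<le> M * (norm (t k *\<^sub>R v k))\<^sup>2"
      using le[OF C[of k]] by (simp add: dist_norm)
    then have "t k * (n \<bullet> v k) \<le> t k * (M * t k * (norm (v k))\<^sup>2)"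
      by (simp add: power_mult_distrib power2_eq_square algebra_simps)
    then show ?case using t(1)[of k] by simp
  qed
  have "(\<lambda>k. M * t k * (norm (v k))\<^sup>2) \<longlonglongrightarrow> M * 0 * (norm w)\<^sup>2"
    by (intro tendsto_intros t v)
  moreover have "(\<lambda>k. n \<bullet> v k) \<longlonglongrightarrow> n \<bullet> w"
    by (intro tendsto_intros v)
  ultimately show "n \<bullet> w \<le> 0"
    using tendsto_le[OF sequentially_bot _ _ ev] by simp
qed

text \<open>The radii \<open>inverse (real (Suc k))\<close> turn the approximants back into
  sequences. With this form, the closed graph proof adds two errors \<open>e / 2\<close> instead of
  extracting a diagonal sequence.\<close>

lemma limiting_normal_cone_iff_approx:
  "n \<in> limiting_normal_cone C z \<longleftrightarrow>
     z \<in> C \<and> (\<forall>e>0. \<exists>u\<in>C. \<exists>m\<in>regular_normal_cone C u. dist u z < e \<and> dist m n < e)"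
    (is "?L \<longleftrightarrow> z \<in> C \<and> ?R")
proof
  assume ?L
  then obtain u us where z: "z \<in> C" and u: "u \<longlonglongrightarrow> z" "\<And>k. u k \<in> C"
    and us: "\<And>k. us k \<in> regular_normal_cone C (u k)" "us \<longlonglongrightarrow> n"
    unfolding limiting_normal_cone_def by blast
  have ?R
  proof (intro allI impI)
    fix e :: real assume "e > 0"
    then have "\<forall>\<^sub>F k in sequentially. dist (u k) z < e \<and> dist (us k) n < e"
      using tendstoD[OF u(1)] tendstoD[OF us(2)] by (simp add: eventually_conj)
    then obtain k where "dist (u k) z < e" "dist (us k) n < e"
      using eventually_happens by force
    then show "\<exists>u\<in>C. \<exists>m\<in>regular_normal_cone C u. dist u z < e \<and> dist m n < e"
      using u us by blast
  qed
  with z show "z \<in> C \<and> ?R" by blast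
next
  assume R: "z \<in> C \<and> ?R"
  have "\<forall>k. \<exists>u m. u \<in> C \<and> m \<in> regular_normal_cone C u \<and>
          dist u z < inverse (real (Suc k)) \<and> dist m n < inverse (real (Suc k))"
    using R by (metis inverse_positive_iff_positive of_nat_0_less_iff zero_less_Suc)
  then obtain u us where *: "\<And>k. u k \<in> C" "\<And>k. us k \<in> regular_normal_cone C (u k)"
    "\<And>k. dist (u k) z < inverse (real (Suc k))" "\<And>k. dist (us k) n < inverse (real (Suc k))"
    by metis
  have "u \<longlonglongrightarrow> z" "us \<longlonglongrightarrow> n"
    using *(3,4) by (auto intro: LIMSEQ_dist_less_inverse)
  then show ?L
    unfolding limiting_normal_cone_def using R *(1,2) by blast
qed

lemma regular_normal_imp_limiting_normal:
  "u \<in> C \<Longrightarrow> n \<in> regular_normal_cone C u \<Longrightarrow> n \<in> limiting_normal_cone C u"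
  unfolding limiting_normal_cone_iff_approx by force

lemma limiting_normal_cone_closed_graph:
  assumes "z \<in> C" and u: "u \<longlonglongrightarrow> z" and n: "n \<longlonglongrightarrow> n'"
    and N: "\<And>k. n k \<in> limiting_normal_cone C (u k)"
  shows "n' \<in> limiting_normal_cone C z"
  unfolding limiting_normal_cone_iff_approx
proof (intro conjI allI impI \<open>z \<in> C\<close>)
  fix e :: real assume "e > 0"
  then have "\<forall>\<^sub>F k in sequentially. dist (u k) z < e / 2 \<and> dist (n k) n' < e / 2"
    by (intro eventually_conj tendstoD[OF u] tendstoD[OF n]) auto
  then obtain k where k: "dist (u k) z < e / 2" "dist (n k) n' < e / 2"
    using eventually_happens by force
  have "e / 2 > 0" using \<open>e > 0\<close> by simp
  then obtain q m where qm: "q \<in> C" "m \<in> regular_normal_cone C q"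
    "dist q (u k) < e / 2" "dist m (n k) < e / 2"
    using N[of k] unfolding limiting_normal_cone_iff_approx by blast
  with k have "dist q z < e" "dist m n' < e"
    by (metis dist_triangle_half_l dist_commute)+
  with qm show "\<exists>u\<in>C. \<exists>m\<in>regular_normal_cone C u. dist u z < e \<and> dist m n' < e" by blast
qed

lemma limiting_normal_cone_scaleR:
  assumes "n \<in> limiting_normal_cone C z" "c \<ge> 0"
  shows "c *\<^sub>R n \<in> limiting_normal_cone C z"
proof -
  obtain u us where z: "z \<in> C" and u: "u \<longlonglongrightarrow> z" "\<And>k. u k \<in> C"
    and us: "\<And>k. us k \<in> regular_normal_cone C (u k)" "us \<longlonglongrightarrow> n"
    using assms unfolding limiting_normal_cone_def by blast
  have "c *\<^sub>R us k \<in> regular_normal_cone C (u k)" for k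
    using us(1)[of k] \<open>c \<ge> 0\<close>
    unfolding regular_normal_cone_def polar_cone_def by (simp add: mult_nonneg_nonpos)
  moreover have "(\<lambda>k. c *\<^sub>R us k) \<longlonglongrightarrow> c *\<^sub>R n"
    by (intro tendsto_intros us)
  ultimately show ?thesis
    unfolding limiting_normal_cone_def using z u
    by (intro CollectI conjI exI[of _ u] exI[of _ "\<lambda>k. c *\<^sub>R us k"] allI) auto
qed

section \<open>Kernel condition on limiting normals: uniform bound and existence\<close>

text \<open>Otherwise radius \<open>1/(k+1)\<close> and constant \<open>k+1\<close> fail for every
  \<open>k\<close>. The offending normals, scaled to norm one, accumulate at a unit normal at
  \<open>z\<close> that \<open>P\<close> maps to zero, against \<open>ker\<close>. In the
  applications \<open>P\<close> is the projection to the \<open>y\<close>-component and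
  \<open>ker\<close> is the qualification condition.\<close>

lemma limiting_normals_uniformly_bounded:
  fixes C :: "'a::euclidean_space set" and P :: "'a \<Rightarrow> 'b::real_normed_vector"
  assumes "z \<in> C" and P: "bounded_linear P"
    and ker: "\<And>n. n \<in> limiting_normal_cone C z \<Longrightarrow> P n = 0 \<Longrightarrow> n = 0"
  obtains \<delta> K where "\<delta> > 0" "K > 0"
    "\<And>u n. dist u z < \<delta> \<Longrightarrow> n \<in> limiting_normal_cone C u \<Longrightarrow> norm n \<le> K * norm (P n)"
proof (rule ccontr)
  assume contra: "\<not> thesis"
  have "\<exists>u n. dist u z < inverse (real (Suc k)) \<and> n \<in> limiting_normal_cone C u \<and>
          norm n > real (Suc k) * norm (P n)" for k
    using that[of "inverse (real (Suc k))" "real (Suc k)"] contra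
    by (metis inverse_positive_iff_positive not_less of_nat_0_less_iff zero_less_Suc)
  then obtain u n where u: "\<And>k. dist (u k) z < inverse (real (Suc k))"
    and n: "\<And>k. n k \<in> limiting_normal_cone C (u k)"
    and gt: "\<And>k. norm (n k) > real (Suc k) * norm (P (n k))"
    by metis
  interpret P: bounded_linear P by (fact P)
  define m where "m k = inverse (norm (n k)) *\<^sub>R n k" for k
  \<comment> \<open>Strictness in \<open>gt\<close> rules out \<open>n k = 0\<close>, so the
    normalisation in \<open>m\<close> is legitimate.\<close>
  have pos: "norm (n k) > 0" for k
    using gt[of k] by (smt (verit) mult_nonneg_nonneg norm_ge_zero of_nat_0_le_iff)
  have m1: "norm (m k) = 1" for k using pos[of k] by (simp add: m_def)
  have Pm: "norm (P (m k)) \<le> inverse (real (Suc k))" for k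
  proof -
    have "norm (P (m k)) = norm (P (n k)) / norm (n k)"
      by (simp add: m_def P.scaleR divide_inverse_commute)
    also have "\<dots> \<le> inverse (real (Suc k))"
      using gt[of k] pos[of k] by (simp add: field_simps)
    finally show ?thesis .
  qed
  have "m k \<in> sphere 0 1" for k using m1 by simp
  then obtain l s where l: "l \<in> sphere 0 1" "strict_mono s" "(m \<circ> s) \<longlonglongrightarrow> l"
    using compact_sphere[of "0::'a" 1] unfolding compact_def by metis
  have "u \<longlonglongrightarrow> z"
    using u by (rule LIMSEQ_dist_less_inverse)
  then have us: "(u \<circ> s) \<longlonglongrightarrow> z" using l(2) LIMSEQ_subseq_LIMSEQ by blast
  have N: "l \<in> limiting_normal_cone C z"
    by (rule limiting_normal_cone_closed_graph[OF \<open>z \<in> C\<close> us l(3)])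
      (simp add: m_def limiting_normal_cone_scaleR n)
  have "(\<lambda>k. P (m k)) \<longlonglongrightarrow> 0"
    by (rule Lim_null_comparison[OF _ LIMSEQ_inverse_real_of_nat])
      (intro always_eventually allI Pm)
  then have "((\<lambda>k. P (m k)) \<circ> s) \<longlonglongrightarrow> 0" using l(2) LIMSEQ_subseq_LIMSEQ by blast
  moreover have "(\<lambda>k. P ((m \<circ> s) k)) \<longlonglongrightarrow> P l"
    by (rule P.tendsto[OF l(3)])
  ultimately have "P l = 0"
    by (simp add: o_def LIMSEQ_unique)
  with ker N l(1) show False by force
qed

text \<open>The points \<open>q\<close> minimise \<open>a \<bullet> q + k * (norm (Q (q - p)))\<^sup>2\<close> over \<open>C\<close> near \<open>p\<close>; as \<open>k\<close> grows,
  the isolatedness assumption forces them to \<open>p\<close>.\<close>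
lemma regular_normals_near_isolated_point:
  fixes C :: "'a::euclidean_space set"
  assumes "p \<in> C" and cl: "locally_closed_at C p"
    and Q: "bounded_linear Q" and self_adjoint: "\<And>v w. Q v \<bullet> w = v \<bullet> Q w"
    and "r > 0" and isol: "\<And>q. q \<in> C \<Longrightarrow> dist q p < r \<Longrightarrow> Q q = Q p \<Longrightarrow> q = p"
    and "\<delta> > 0"
  obtains q n where "q \<in> C" "dist q p < \<delta>" "n \<in> regular_normal_cone C q" "n + a \<in> range Q"
proof -
  interpret Q: bounded_linear Q by (fact Q)
  obtain r0 where r0: "r0 > 0" "closed (C \<inter> cball p r0)"
    using cl unfolding locally_closed_at_def by blast
  \<comment> \<open>The bound \<open>r0\<close> makes \<open>B\<close> closed, hence compact;
    \<open>r / 2\<close> keeps the closed ball inside the open ball on which \<open>isol\<close>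
    applies.\<close>
  define \<rho> where "\<rho> = min r0 (r / 2)"
  define B where "B = C \<inter> cball p \<rho>"
  have \<rho>: "\<rho> > 0" "\<rho> < r" using r0 \<open>r > 0\<close> by (auto simp: \<rho>_def)
  have "B = (C \<inter> cball p r0) \<inter> cball p \<rho>" by (auto simp: B_def \<rho>_def)
  then have cB: "compact B" using r0 by (simp add: closed_Int_compact)
  have pB: "p \<in> B" using \<open>p \<in> C\<close> \<rho> by (simp add: B_def)
  define f where "f k q = a \<bullet> q + real k * (norm (Q (q - p)))\<^sup>2" for k q
  have "\<exists>q\<in>B. \<forall>y\<in>B. f k q \<le> f k y" for k
    unfolding f_def
    by (intro continuous_attains_inf cB continuous_intros Q.continuous_on) (use pB in auto)
  then obtain g where gB: "\<And>k. g k \<in> B" and gmin: "\<And>k y. y \<in> B \<Longrightarrow> f k (g k) \<le> f k y"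
    by metis
  \<comment> \<open>Comparison of the minimiser with \<open>p\<close>, where the penalty vanishes.
    The bound does not depend on \<open>k\<close>, so \<open>Q (g k - p)\<close> tends to zero and
    every cluster point \<open>l\<close> has \<open>Q l = Q p\<close>.\<close>
  have pen: "real k * (norm (Q (g k - p)))\<^sup>2 \<le> norm a * \<rho>" for k
  proof -
    have "f k (g k) \<le> a \<bullet> p" using gmin[OF pB, of k] by (simp add: f_def Q.zero)
    then have "real k * (norm (Q (g k - p)))\<^sup>2 \<le> a \<bullet> (p - g k)"
      by (simp add: f_def inner_diff_right)
    also have "\<dots> \<le> norm a * norm (p - g k)" by (rule norm_cauchy_schwarz)
    also have "\<dots> \<le> norm a * \<rho>"
      using gB[of k] by (intro mult_left_mono) (auto simp: B_def dist_norm)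
    finally show ?thesis .
  qed
  obtain l s where l: "l \<in> B" "strict_mono s" "(g \<circ> s) \<longlonglongrightarrow> l"
    using cB gB unfolding compact_def by metis
  have "(\<lambda>k. (norm (Q (g k - p)))\<^sup>2) \<longlonglongrightarrow> 0"
  proof (rule Lim_null_comparison)
    show "\<forall>\<^sub>F k in sequentially. norm ((norm (Q (g k - p)))\<^sup>2) \<le> (norm a * \<rho>) / real k"
      using eventually_gt_at_top[of 0]
      by eventually_elim (use pen in \<open>simp add: field_simps\<close>)
    show "(\<lambda>k. norm a * \<rho> / real k) \<longlonglongrightarrow> 0"
      by (rule lim_const_over_n)
  qed
  then have "((\<lambda>k. (norm (Q (g k - p)))\<^sup>2) \<circ> s) \<longlonglongrightarrow> 0"
    using l(2) LIMSEQ_subseq_LIMSEQ by blast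
  moreover have "(\<lambda>k. (norm (Q ((g \<circ> s) k - p)))\<^sup>2) \<longlonglongrightarrow> (norm (Q (l - p)))\<^sup>2"
    by (intro tendsto_intros Q.tendsto l)
  ultimately have "(norm (Q (l - p)))\<^sup>2 = 0"
    using LIMSEQ_unique by (fastforce simp: o_def)
  then have "Q l = Q p" by (simp add: Q.diff)
  then have "l = p" using isol[of l] l(1) \<rho> by (auto simp: B_def dist_commute)
  then have "\<forall>\<^sub>F k in sequentially. dist ((g \<circ> s) k) p < min \<delta> \<rho>"
    using tendstoD[OF l(3), of "min \<delta> \<rho>"] \<open>\<delta> > 0\<close> \<rho> by simp
  then obtain j where "dist ((g \<circ> s) j) p < min \<delta> \<rho>"
    using eventually_happens by force
  \<comment> \<open>The distance below \<open>\<rho>\<close> puts \<open>g k\<close> in the interior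
    of the ball, so \<open>g k\<close> is a local minimiser of \<open>f k\<close> over
    \<open>C\<close> and not merely over \<open>B\<close>.\<close>
  then obtain k where k: "dist (g k) p < \<delta>" "dist (g k) p < \<rho>" by auto
  \<comment> \<open>The negative gradient of \<open>f k\<close> at \<open>g k\<close>: since
    \<open>Q\<close> is self-adjoint, the gradient of the squared norm of \<open>Q (q - p)\<close>
    is \<open>2 * Q (Q (q - p))\<close>. All of it except \<open>- a\<close> lies in the range of
    \<open>Q\<close>.\<close>
  define n where "n = - a - (2 * real k) *\<^sub>R Q (Q (g k - p))"
  obtain M where M: "M > 0" "\<And>h. norm (Q h) \<le> norm h * M" using Q.pos_bounded by blast
  have "n \<in> regular_normal_cone C (g k)"
  proof (rule proximal_normal_in_regular_normal_cone)
    show "\<rho> - dist (g k) p > 0" using k by simp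
    fix q assume q: "q \<in> C" "dist q (g k) < \<rho> - dist (g k) p"
    then have "q \<in> B"
      using dist_triangle[of q p "g k"] by (simp add: B_def dist_commute)
    then have min: "f k (g k) \<le> f k q" by (rule gmin)
    define h where "h = q - g k"
    have "Q (q - p) = Q (g k - p) + Q h" by (simp add: h_def flip: Q.add)
    \<comment> \<open>The expansion is exact because the penalty is quadratic. Minimality of
      \<open>g k\<close> therefore becomes the one-sided quadratic bound that makes \<open>n\<close>
      a regular normal.\<close>
    then have expand: "(norm (Q (q - p)))\<^sup>2 =
        (norm (Q (g k - p)))\<^sup>2 + 2 * (Q (Q (g k - p)) \<bullet> h) + (norm (Q h))\<^sup>2"
      by (simp add: power2_norm_eq_inner inner_add_left inner_add_right self_adjoint[of "Q (g k - p)"]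
          inner_commute[of "Q h" "Q (g k - p)"])
    have "a \<bullet> q = a \<bullet> g k + a \<bullet> h"
      by (simp add: h_def inner_diff_right)
    then have "f k q - f k (g k) = real k * (norm (Q h))\<^sup>2 - n \<bullet> h"
      unfolding f_def expand by (simp add: n_def inner_diff_left distrib_left)
    then have "n \<bullet> h \<le> real k * (norm (Q h))\<^sup>2" using min by simp
    also have "\<dots> \<le> real k * (norm h * M)\<^sup>2"
      by (intro mult_left_mono power_mono M) auto
    finally show "n \<bullet> (q - g k) \<le> (real k * M\<^sup>2) * (norm (q - g k))\<^sup>2"
      by (simp add: h_def power_mult_distrib mult_ac)
  qed
  moreover have "n + a = Q (- (2 * real k) *\<^sub>R Q (g k - p))"
    by (simp add: n_def Q.scaleR Q.neg)
  then have "n + a \<in> range Q" by simp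
  ultimately show thesis using that gB[of k] k by (auto simp: B_def)
qed

text \<open>Regular normals at points tending to \<open>p\<close> have the required image under
  \<open>P\<close>, because they differ from \<open>a\<close> by an element of the range of
  \<open>Q\<close>, which \<open>P\<close> annihilates. The uniform bound in terms of this fixed
  image makes them bounded, and the closed graph places their cluster point at
  \<open>p\<close>.\<close>

lemma limiting_normal_with_prescribed_component:
  fixes C :: "'a::euclidean_space set" and P :: "'a \<Rightarrow> 'b::real_normed_vector"
  assumes "p \<in> C" and cl: "locally_closed_at C p"
    and P: "bounded_linear P" and Q: "bounded_linear Q"
    and self_adjoint: "\<And>v w. Q v \<bullet> w = v \<bullet> Q w" and PQ: "\<And>v. P (Q v) = 0"
    and ker: "\<And>n. n \<in> limiting_normal_cone C p \<Longrightarrow> P n = 0 \<Longrightarrow> n = 0"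
    and "r > 0" and isol: "\<And>q. q \<in> C \<Longrightarrow> dist q p < r \<Longrightarrow> Q q = Q p \<Longrightarrow> q = p"
  obtains n where "n \<in> limiting_normal_cone C p" "P n = P a"
proof -
  interpret P: bounded_linear P by (fact P)
  obtain \<delta> K where \<delta>: "\<delta> > 0" "K > 0"
    and bnd: "\<And>u n. dist u p < \<delta> \<Longrightarrow> n \<in> limiting_normal_cone C u \<Longrightarrow> norm n \<le> K * norm (P n)"
    using limiting_normals_uniformly_bounded[OF \<open>p \<in> C\<close> P ker] by blast
  have "\<exists>q n. dist q p < min \<delta> (inverse (real (Suc k))) \<and> n \<in> limiting_normal_cone C q \<and> P n = P a"
    for k
  proof -
    have "min \<delta> (inverse (real (Suc k))) > 0" using \<delta> by simp
    \<comment> \<open>The linear term is \<open>- a\<close>, so that \<open>n - a\<close> lies in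
      the range of \<open>Q\<close>. The cap \<open>\<delta>\<close> on the radius is what makes
      \<open>bnd\<close> available for these normals.\<close>
    from regular_normals_near_isolated_point[OF \<open>p \<in> C\<close> cl Q self_adjoint \<open>r > 0\<close> isol this, of "- a"]
    obtain q n where qn: "q \<in> C" "dist q p < min \<delta> (inverse (real (Suc k)))"
        "n \<in> regular_normal_cone C q" "n + - a \<in> range Q"
      by blast
    then have "P (n + - a) = 0" using PQ by force
    then have "P n = P a" by (simp add: P.diff)
    with qn regular_normal_imp_limiting_normal show ?thesis by blast
  qed
  then obtain q n where q: "\<And>k. dist (q k) p < min \<delta> (inverse (real (Suc k)))"
    and n: "\<And>k. n k \<in> limiting_normal_cone C (q k)" and Pn: "\<And>k. P (n k) = P a"
    by metis
  have "n k \<in> cball 0 (K * norm (P a))" for k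
    using bnd[OF _ n[of k]] q[of k] Pn[of k] by simp
  then obtain l s where l: "strict_mono s" "(n \<circ> s) \<longlonglongrightarrow> l"
    using compact_cball[of "0::'a" "K * norm (P a)"] unfolding compact_def by metis
  have "q \<longlonglongrightarrow> p"
    by (rule LIMSEQ_dist_less_inverse) (use q in simp)
  then have "(q \<circ> s) \<longlonglongrightarrow> p" using l(1) LIMSEQ_subseq_LIMSEQ by blast
  then have "l \<in> limiting_normal_cone C p"
    by (rule limiting_normal_cone_closed_graph[OF \<open>p \<in> C\<close> _ l(2)]) (simp add: n)
  moreover have "P l = P a"
    using LIMSEQ_unique[OF P.tendsto[OF l(2)]] Pn by (simp add: o_def)
  ultimately show thesis by (rule that)
qed

section \<open>The implicit coderivative: nonempty values, bounds and the first-order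
  estimate\<close>

text \<open>The minus sign that the coderivative puts on \<open>zs\<close> is absorbed by the
  existential quantifier.\<close>

lemma mem_implicit_coderivative_iff:
  "xs \<in> implicit_coderivative F x y ys \<longleftrightarrow>
     (\<exists>zs. ((xs, - ys), zs) \<in> limiting_normal_cone (gph F) ((x, y), 0))"
  unfolding implicit_coderivative_def coderivative_def
  by (auto intro: exI[of _ "- zs" for zs])

text \<open>\<open>P\<close> extracts the \<open>y\<close>-component and \<open>Q\<close> erases it.
  A graph point with the same image under \<open>Q\<close> as \<open>((x, y), 0)\<close> has the
  form \<open>((x, y'), 0)\<close> with \<open>0 \<in> F (x, y')\<close>, so \<open>isol\<close> is
  exactly the isolatedness required of the graph.\<close>

lemma implicit_coderivative_nonempty:
  fixes F :: "((real ^ 'n) \<times> (real ^ 'm), real ^ 'l) multifunction"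
  assumes zero: "0 \<in> F (x, y)" and cl: "locally_closed_at (gph F) ((x, y), 0)"
    and cq: "\<And>xs zs. (xs, 0) \<in> coderivative F (x, y) 0 zs \<Longrightarrow> zs = 0 \<and> xs = 0"
    and "open V" "y \<in> V" and isol: "\<And>y'. y' \<in> V \<Longrightarrow> 0 \<in> F (x, y') \<Longrightarrow> y' = y"
  shows "implicit_coderivative F x y ys \<noteq> {}"
proof -
  define P :: "((real ^ 'n) \<times> (real ^ 'm)) \<times> (real ^ 'l) \<Rightarrow> real ^ 'm" where "P v = snd (fst v)" for v
  define Q :: "((real ^ 'n) \<times> (real ^ 'm)) \<times> (real ^ 'l) \<Rightarrow> ((real ^ 'n) \<times> (real ^ 'm)) \<times> (real ^ 'l)"
    where "Q v = ((fst (fst v), 0), snd v)" for v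
  have P: "bounded_linear P" unfolding P_def
    by (intro bounded_linear_intros)
  have Q: "bounded_linear Q" unfolding Q_def
    by (intro bounded_linear_Pair bounded_linear_intros)
  obtain r where r: "r > 0" "ball y r \<subseteq> V"
    using \<open>open V\<close> \<open>y \<in> V\<close> openE by blast
  have "((x, y), 0) \<in> gph F" using zero by (simp add: gph_def)
  moreover note cl P Q
  moreover have "Q v \<bullet> w = v \<bullet> Q w" for v w by (simp add: Q_def inner_prod_def)
  moreover have "P (Q v) = 0" for v by (simp add: P_def Q_def)
  moreover have "n = 0" if "n \<in> limiting_normal_cone (gph F) ((x, y), 0)" "P n = 0" for n
  proof -
    obtain xs zs where n: "n = ((xs, 0), zs)"
      using \<open>P n = 0\<close> by (metis P_def prod.collapse)
    then show ?thesis using cq[of xs "- zs"] that by (simp add: coderivative_def zero_prod_def)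
  qed
  moreover note \<open>r > 0\<close>
  moreover have "q = ((x, y), 0)"
    if q: "q \<in> gph F" "dist q ((x, y), 0) < r" "Q q = Q ((x, y), 0)" for q
  proof -
    obtain y' where y': "q = ((x, y'), 0)"
      using q(3) by (metis Q_def fst_conv snd_conv prod.collapse)
    with q r have "y' \<in> V" by (auto simp: dist_Pair_Pair dist_commute)
    moreover have "0 \<in> F (x, y')" using q y' by (simp add: gph_def)
    ultimately show ?thesis using isol y' by blast
  qed
  ultimately obtain n where n: "n \<in> limiting_normal_cone (gph F) ((x, y), 0)" "P n = P ((0, - ys), 0)"
    by (rule limiting_normal_with_prescribed_component)
  have "n = ((fst (fst n), - ys), snd n)"
    using n(2) by (metis P_def fst_conv snd_conv prod.collapse)
  with n(1) show ?thesis using mem_implicit_coderivative_iff by (metis empty_iff)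
qed

text \<open>The tuple \<open>(zs, (xs, - ys))\<close> is the one whose norm occurs in the
  semismooth* inequality for \<open>F\<close>. The bound replaces that norm by a multiple of
  \<open>norm ys\<close>, which removes the uncontrolled \<open>zs\<close>.\<close>

lemma implicit_normals_uniformly_bounded:
  fixes F :: "((real ^ 'n) \<times> (real ^ 'm), real ^ 'l) multifunction"
  assumes zero: "0 \<in> F (x, y)"
    and cq: "\<And>xs zs. (xs, 0) \<in> coderivative F (x, y) 0 zs \<Longrightarrow> zs = 0 \<and> xs = 0"
  obtains \<delta> K where "\<delta> > 0" "K > 0"
    "\<And>x' y' xs ys zs. dist (x', y') (x, y) < \<delta> \<Longrightarrow> (xs, - ys) \<in> coderivative F (x', y') 0 zs
       \<Longrightarrow> norm (zs, (xs, - ys)) \<le> K * norm ys"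
proof -
  define P :: "((real ^ 'n) \<times> (real ^ 'm)) \<times> (real ^ 'l) \<Rightarrow> real ^ 'm" where "P v = snd (fst v)" for v
  have P: "bounded_linear P" unfolding P_def
    by (intro bounded_linear_intros)
  have ker: "n = 0" if "n \<in> limiting_normal_cone (gph F) ((x, y), 0)" "P n = 0" for n
  proof -
    obtain xs zs where n: "n = ((xs, 0), zs)"
      using \<open>P n = 0\<close> by (metis P_def prod.collapse)
    then show ?thesis using cq[of xs "- zs"] that by (simp add: coderivative_def zero_prod_def)
  qed
  have "((x, y), 0) \<in> gph F" using zero by (simp add: gph_def)
  then obtain \<delta> K where \<delta>K: "\<delta> > 0" "K > 0"
    and bnd: "\<And>u n. dist u ((x, y), 0) < \<delta> \<Longrightarrow> n \<in> limiting_normal_cone (gph F) u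
      \<Longrightarrow> norm n \<le> K * norm (P n)"
    using limiting_normals_uniformly_bounded[OF _ P ker] by blast
  show thesis
  proof (rule that[OF \<delta>K])
    fix x' y' xs ys zs
    assume d: "dist (x', y') (x, y) < \<delta>" and N: "(xs, - ys) \<in> coderivative F (x', y') 0 zs"
    then have "norm ((xs, - ys), - zs) \<le> K * norm ys"
      using bnd[of "((x', y'), 0)" "((xs, - ys), - zs)"]
      by (simp add: dist_Pair_Pair coderivative_def P_def)
    then show "norm (zs, (xs, - ys)) \<le> K * norm ys"
      by (simp add: norm_Pair add.commute)
  qed
qed

text \<open>The common source of both semismoothness claims. The estimate is uniform in
  \<open>ys\<close>, so it serves fixed unit vectors as well as the varying second blocks of
  elements of \<open>\<Phi>\<close>.\<close>

lemma implicit_coderivative_estimate: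
  fixes F :: "((real ^ 'n) \<times> (real ^ 'm), real ^ 'l) multifunction"
  assumes "open \<Omega>" "x \<in> \<Omega>" and cont: "continuous_on \<Omega> \<sigma>"
    and zero: "\<And>u. u \<in> \<Omega> \<Longrightarrow> 0 \<in> F (u, \<sigma> u)"
    and ss: "semismooth_star F (x, \<sigma> x) 0"
    and cq: "\<And>xs zs. (xs, 0) \<in> coderivative F (x, \<sigma> x) 0 zs \<Longrightarrow> zs = 0 \<and> xs = 0"
    and ne: "\<And>u ys. u \<in> \<Omega> \<Longrightarrow> implicit_coderivative F u (\<sigma> u) ys \<noteq> {}"
  obtains K where "K > 0"
    "\<forall>\<^sub>F u in nhds x. u \<in> \<Omega> \<and> norm (\<sigma> u - \<sigma> x) \<le> K * norm (u - x)
       \<and> (\<forall>ys. \<forall>xs \<in> implicit_coderivative F u (\<sigma> u) ys. norm xs \<le> K * norm ys)"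
    "\<And>\<epsilon>. \<epsilon> > 0 \<Longrightarrow> \<forall>\<^sub>F u in nhds x. \<forall>ys. \<forall>xs \<in> implicit_coderivative F u (\<sigma> u) ys.
       \<bar>xs \<bullet> (u - x) - ys \<bullet> (\<sigma> u - \<sigma> x)\<bar> \<le> \<epsilon> * norm (u - x) * norm ys"
proof -
  obtain \<delta> K where \<delta>: "\<delta> > 0" and "K > 0"
    and bnd: "\<And>x' y' xs ys zs. dist (x', y') (x, \<sigma> x) < \<delta>
      \<Longrightarrow> (xs, - ys) \<in> coderivative F (x', y') 0 zs \<Longrightarrow> norm (zs, (xs, - ys)) \<le> K * norm ys"
    by (rule implicit_normals_uniformly_bounded[of F x "\<sigma> x"])
      (use zero[OF \<open>x \<in> \<Omega>\<close>] cq in blast)+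
  have \<sigma>: "(\<sigma> \<longlongrightarrow> \<sigma> x) (nhds x)"
    using cont \<open>open \<Omega>\<close> \<open>x \<in> \<Omega>\<close>
    by (metis at_within_open continuous_on_def tendsto_at_iff_tendsto_nhds)
  have pair: "((\<lambda>u. (u, \<sigma> u)) \<longlongrightarrow> (x, \<sigma> x)) (nhds x)"
    by (intro tendsto_Pair \<sigma> filterlim_ident)
  have \<Omega>: "\<forall>\<^sub>F u in nhds x. u \<in> \<Omega>"
    using \<open>open \<Omega>\<close> \<open>x \<in> \<Omega>\<close> eventually_nhds_in_open by blast
  have norm_xs: "\<forall>\<^sub>F u in nhds x. \<forall>ys. \<forall>xs \<in> implicit_coderivative F u (\<sigma> u) ys. norm xs \<le> K * norm ys"
    using tendstoD[OF pair \<delta>]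
  proof eventually_elim
    case (elim u)
    show ?case
    proof (intro allI ballI)
      fix ys xs assume "xs \<in> implicit_coderivative F u (\<sigma> u) ys"
      then obtain zs where "(xs, - ys) \<in> coderivative F (u, \<sigma> u) 0 zs"
        by (auto simp: implicit_coderivative_def)
      from bnd[OF elim this] have "norm (zs, (xs, - ys)) \<le> K * norm ys" .
      moreover have "norm xs \<le> norm (zs, (xs, - ys))"
        using norm_fst_le[of xs "- ys"] norm_snd_le[of "(xs, - ys)" zs] by linarith
      ultimately show "norm xs \<le> K * norm ys" by linarith
    qed
  qed
  have estimate: "\<forall>\<^sub>F u in nhds x. \<forall>ys. \<forall>xs \<in> implicit_coderivative F u (\<sigma> u) ys.
       \<bar>xs \<bullet> (u - x) - ys \<bullet> (\<sigma> u - \<sigma> x)\<bar> \<le> \<epsilon> * (norm (u - x) + norm (\<sigma> u - \<sigma> x)) * norm ys"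
    if "\<epsilon> > 0" for \<epsilon>
  proof -
    \<comment> \<open>The division by \<open>K\<close> cancels the constant from
      \<open>bnd\<close>.\<close>
    have "\<epsilon> / K > 0" using that \<open>K > 0\<close> by simp
    then obtain \<eta> where \<eta>: "\<eta> > 0" and ss': "\<And>p z xs zs. (p, z) \<in> gph F
        \<Longrightarrow> norm ((p, z) - ((x, \<sigma> x), 0)) \<le> \<eta> \<Longrightarrow> xs \<in> coderivative F p z zs
        \<Longrightarrow> \<bar>xs \<bullet> (p - (x, \<sigma> x)) - zs \<bullet> (z - 0)\<bar>
              \<le> \<epsilon> / K * norm ((p, z) - ((x, \<sigma> x), 0)) * norm (zs, xs)"
      using ss unfolding semismooth_star_def by (fastforce simp: gph_def)
    from tendstoD[OF pair \<delta>] tendstoD[OF pair \<eta>] \<Omega> show ?thesis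
    proof eventually_elim
      case (elim u)
      show ?case
      proof (intro allI ballI)
        fix ys xs assume "xs \<in> implicit_coderivative F u (\<sigma> u) ys"
        then obtain zs where zs: "(xs, - ys) \<in> coderivative F (u, \<sigma> u) 0 zs"
          by (auto simp: implicit_coderivative_def)
        let ?d = "norm ((u, \<sigma> u) - (x, \<sigma> x))"
        \<comment> \<open>Both graph points have third component zero, so the \<open>zs\<close> term
          drops out of the left side of the semismooth* inequality.\<close>
        have "((u, \<sigma> u), 0) \<in> gph F" using zero elim by (simp add: gph_def)
        from ss'[OF this _ zs] elim(2)
        have "\<bar>xs \<bullet> (u - x) - ys \<bullet> (\<sigma> u - \<sigma> x)\<bar> \<le> \<epsilon> / K * ?d * norm (zs, (xs, - ys))"
          by (simp add: norm_Pair dist_norm)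
        also have "\<dots> \<le> \<epsilon> / K * ?d * (K * norm ys)"
          using bnd[OF elim(1) zs] that \<open>K > 0\<close> by (intro mult_left_mono) auto
        also have "\<dots> = \<epsilon> * norm ys * ?d" using \<open>K > 0\<close> by simp
        also have "\<dots> \<le> \<epsilon> * norm ys * (norm (u - x) + norm (\<sigma> u - \<sigma> x))"
          using that norm_Pair_le[of "u - x" "\<sigma> u - \<sigma> x"] by (intro mult_left_mono) auto
        finally show "\<bar>xs \<bullet> (u - x) - ys \<bullet> (\<sigma> u - \<sigma> x)\<bar>
            \<le> \<epsilon> * (norm (u - x) + norm (\<sigma> u - \<sigma> x)) * norm ys"
          by (simp add: mult_ac)
      qed
    qed
  qed
  \<comment> \<open>With \<open>1/2\<close> in place of \<epsilon> in \<open>estimate\<close>, half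
    of \<open>norm d\<close> is absorbed on the left, which leaves
    \<open>norm d \<le> (1 + 2 * K) * norm (u - x)\<close>.\<close>
  define L where "L = 2 * K + 1"
  have calm: "\<forall>\<^sub>F u in nhds x. norm (\<sigma> u - \<sigma> x) \<le> L * norm (u - x)"
    using estimate[OF half_gt_zero[OF zero_less_one]] norm_xs \<Omega>
  proof eventually_elim
    case (elim u)
    \<comment> \<open>The choice \<open>y\<^sup>* = d\<close> makes the estimate quadratic in \<open>norm d\<close>.\<close>
    define d where "d = \<sigma> u - \<sigma> x"
    obtain xs where xs: "xs \<in> implicit_coderivative F u (\<sigma> u) d"
      using ne \<open>u \<in> \<Omega>\<close> by blast
    have "\<bar>xs \<bullet> (u - x) - d \<bullet> d\<bar> \<le> 1/2 * (norm (u - x) + norm d) * norm d"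
      using elim xs by (auto simp: d_def)
    moreover have "xs \<bullet> (u - x) \<le> norm xs * norm (u - x)" by (rule norm_cauchy_schwarz)
    moreover have "norm xs * norm (u - x) \<le> (K * norm d) * norm (u - x)"
      using elim xs by (intro mult_right_mono) auto
    moreover have "d \<bullet> d = norm d * norm d"
      by (metis power2_norm_eq_inner power2_eq_square)
    ultimately have "norm d * norm d \<le> 1/2 * (norm (u - x) + norm d) * norm d + (K * norm d) * norm (u - x)"
      by linarith
    then have "norm d * norm d \<le> norm d * (1/2 * (norm (u - x) + norm d) + K * norm (u - x))"
      by (simp add: algebra_simps)
    then have "norm d \<le> 1/2 * (norm (u - x) + norm d) + K * norm (u - x) \<or> d = 0"
      by (metis mult_le_cancel_left_pos zero_less_norm_iff)
    moreover have "0 \<le> L * norm (u - x)" using \<open>K > 0\<close> by (simp add: L_def)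
    ultimately have "norm d \<le> L * norm (u - x)"
      by (auto simp: L_def algebra_simps)
    then show ?case by (simp add: d_def)
  qed
  show thesis
  proof (rule that)
    show "L > 0" using \<open>K > 0\<close> by (simp add: L_def)
    \<comment> \<open>Since \<open>K \<le> L\<close>, the single constant \<open>L\<close> covers
      both the calmness of \<open>\<sigma>\<close> and the bound on \<open>xs\<close>.\<close>
    have "K * t \<le> L * t" if "t \<ge> 0" for t
      using that \<open>K > 0\<close> by (intro mult_right_mono) (auto simp: L_def)
    then have KL: "K * norm y \<le> L * norm y" for y :: "real ^ 'm" by simp
    show "\<forall>\<^sub>F u in nhds x. u \<in> \<Omega> \<and> norm (\<sigma> u - \<sigma> x) \<le> L * norm (u - x)
       \<and> (\<forall>ys. \<forall>xs \<in> implicit_coderivative F u (\<sigma> u) ys. norm xs \<le> L * norm ys)"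
      using \<Omega> calm norm_xs by eventually_elim (meson KL order_trans)
    fix \<epsilon> :: real assume "\<epsilon> > 0"
    \<comment> \<open>Calmness bounds the sum of the two norms in \<open>estimate\<close> by
      \<open>(1 + L) * norm (u - x)\<close>.\<close>
    then have "\<epsilon> / (1 + L) > 0" using \<open>L > 0\<close> by simp
    from estimate[OF this] calm
    show "\<forall>\<^sub>F u in nhds x. \<forall>ys. \<forall>xs \<in> implicit_coderivative F u (\<sigma> u) ys.
       \<bar>xs \<bullet> (u - x) - ys \<bullet> (\<sigma> u - \<sigma> x)\<bar> \<le> \<epsilon> * norm (u - x) * norm ys"
    proof eventually_elim
      case (elim u)
      have "\<epsilon> / (1 + L) * (norm (u - x) + norm (\<sigma> u - \<sigma> x))
          \<le> \<epsilon> / (1 + L) * ((1 + L) * norm (u - x))"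
        using elim(2) \<open>\<epsilon> / (1 + L) > 0\<close> by (intro mult_left_mono) (auto simp: algebra_simps)
      also have "\<dots> = \<epsilon> * norm (u - x)" using \<open>L > 0\<close> by simp
      finally have "\<epsilon> / (1 + L) * (norm (u - x) + norm (\<sigma> u - \<sigma> x)) * norm y
          \<le> \<epsilon> * norm (u - x) * norm y" for y :: "real ^ 'm"
        by (rule mult_right_mono) simp
      with elim(1) show ?case by (meson order_trans)
    qed
  qed
qed

section \<open>Passing between the supremum quotient and pointwise estimates\<close>

text \<open>Nonempty values and the pointwise bound make the real supremum a genuine one, squeezed
  between zero and the bound.\<close>

lemma semismooth_wrt_atI:
  fixes f :: "'a::euclidean_space \<Rightarrow> 'b::euclidean_space"
  assumes "open \<Omega>" "ub \<in> \<Omega>" and ne: "\<And>u. u \<in> \<Omega> \<Longrightarrow> \<Psi> u \<noteq> {}"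
    and bnd: "\<forall>\<^sub>F u in nhds ub. \<forall>A\<in>\<Psi> u. norm A \<le> B"
    and est: "\<And>\<epsilon>. \<epsilon> > 0 \<Longrightarrow> \<forall>\<^sub>F u in nhds ub. u \<noteq> ub \<longrightarrow> (\<forall>A\<in>\<Psi> u.
      norm (f u - f ub - act A (u - ub)) \<le> \<epsilon> * norm (u - ub))"
  shows "semismooth_wrt_at act \<Omega> f \<Psi> ub"
  unfolding semismooth_wrt_at_def
proof (intro conjI \<open>open \<Omega>\<close> \<open>ub \<in> \<Omega>\<close>)
  have "\<Omega> \<subseteq> mdom \<Psi>" using ne by (auto simp: mdom_def)
  then show "ub \<in> interior (mdom \<Psi>)"
    using \<open>open \<Omega>\<close> \<open>ub \<in> \<Omega>\<close> interiorI by blast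
  obtain N where "open N" "ub \<in> N" "\<And>u. u \<in> N \<Longrightarrow> \<forall>A\<in>\<Psi> u. norm A \<le> B"
    using bnd unfolding eventually_nhds by blast
  then show "\<exists>N. open N \<and> ub \<in> N \<and> bounded (\<Union>u\<in>N. \<Psi> u)"
    unfolding bounded_iff by blast
  show "((\<lambda>u. (SUP A\<in>\<Psi> u. norm (f u - f ub - act A (u - ub))) / norm (u - ub)) \<longlongrightarrow> 0)
      (at ub within \<Omega>)"
  proof (rule tendstoI)
    fix e :: real assume "e > 0"
    \<comment> \<open>The half turns the non-strict bound on the supremum into the strict inequality
      of the limit.\<close>
    then have ev: "\<forall>\<^sub>F u in at ub within \<Omega>. u \<noteq> ub \<longrightarrow> (\<forall>A\<in>\<Psi> u.
        norm (f u - f ub - act A (u - ub)) \<le> e / 2 * norm (u - ub))"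
      using est[of "e / 2"] filter_leD[OF at_within_le_nhds] by simp
    have "\<forall>\<^sub>F u in at ub within \<Omega>. u \<in> \<Omega> \<and> u \<noteq> ub"
      by (simp add: eventually_at_filter)
    with ev show "\<forall>\<^sub>F u in at ub within \<Omega>.
      dist ((SUP A\<in>\<Psi> u. norm (f u - f ub - act A (u - ub))) / norm (u - ub)) 0 < e"
    proof eventually_elim
      case (elim u)
      let ?n = "\<lambda>A. norm (f u - f ub - act A (u - ub))"
      have le: "?n A \<le> e / 2 * norm (u - ub)" if "A \<in> \<Psi> u" for A
        using elim that by blast
      obtain A where A: "A \<in> \<Psi> u" using ne elim by blast
      have "bdd_above (?n ` \<Psi> u)" using le by (intro bdd_aboveI2)
      then have "0 \<le> Sup (?n ` \<Psi> u)"
        using A by (meson cSUP_upper norm_ge_zero order_trans)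
      moreover have "Sup (?n ` \<Psi> u) \<le> e / 2 * norm (u - ub)"
        using A le by (intro cSUP_least) auto
      moreover have "norm (u - ub) > 0" using elim by simp
      moreover have "e / 2 * norm (u - ub) < e * norm (u - ub)"
        using \<open>e > 0\<close> elim by simp
      ultimately show ?case by (simp add: field_simps)
    qed
  qed
qed

text \<open>Local boundedness of \<open>\<Phi>\<close> makes the set under the supremum bounded
  above, so each element lies below the supremum. This returns the estimate to a form that can be
  composed with \<open>u \<mapsto> (u, \<sigma> u)\<close>.\<close>

lemma semismooth_row_estimate:
  fixes f :: "'a::euclidean_space \<Rightarrow> real"
  assumes ss: "semismooth_wrt_at (\<bullet>) D f \<Phi> ub" and "\<epsilon> > 0"
  shows "\<forall>\<^sub>F u in nhds ub. u \<noteq> ub \<longrightarrow> (\<forall>A\<in>\<Phi> u. norm (f u - f ub - A \<bullet> (u - ub)) \<le> \<epsilon> * norm (u - ub))"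
proof -
  have D: "open D" "ub \<in> D"
    and lim: "((\<lambda>u. (SUP A\<in>\<Phi> u. norm (f u - f ub - A \<bullet> (u - ub))) / norm (u - ub)) \<longlongrightarrow> 0)
      (at ub within D)"
    using ss by (auto simp: semismooth_wrt_at_def)
  obtain N where "open N" "ub \<in> N" "bounded (\<Union>u\<in>N. \<Phi> u)"
    using ss by (auto simp: semismooth_wrt_at_def)
  then obtain B where B: "\<And>u A. u \<in> N \<Longrightarrow> A \<in> \<Phi> u \<Longrightarrow> norm A \<le> B"
    unfolding bounded_iff by blast
  have "\<forall>\<^sub>F u in nhds ub. u \<in> N"
    using \<open>open N\<close> \<open>ub \<in> N\<close> eventually_nhds_in_open by blast
  moreover have "\<forall>\<^sub>F u in nhds ub. u \<noteq> ub \<longrightarrow>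
      (SUP A\<in>\<Phi> u. norm (f u - f ub - A \<bullet> (u - ub))) / norm (u - ub) < \<epsilon>"
    using order_tendstoD(2)[OF lim \<open>\<epsilon> > 0\<close>] by (simp add: at_within_open[OF D(2,1)] eventually_at_filter)
  ultimately show ?thesis
  proof eventually_elim
    case (elim u)
    show ?case
    proof (intro impI ballI)
      fix A assume "u \<noteq> ub" and A: "A \<in> \<Phi> u"
      let ?n = "\<lambda>A. norm (f u - f ub - A \<bullet> (u - ub))"
      have "?n A' \<le> norm (f u - f ub) + B * norm (u - ub)" if "A' \<in> \<Phi> u" for A'
      proof -
        have "\<bar>A' \<bullet> (u - ub)\<bar> \<le> norm A' * norm (u - ub)" by (rule Cauchy_Schwarz_ineq2)
        also have "\<dots> \<le> B * norm (u - ub)"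
          using B elim(1) that by (intro mult_right_mono) auto
        finally show ?thesis
          using norm_triangle_ineq4[of "f u - f ub" "A' \<bullet> (u - ub)"] by simp
      qed
      then have "bdd_above (?n ` \<Phi> u)" by (intro bdd_aboveI2)
      then have "?n A \<le> Sup (?n ` \<Phi> u)" using A by (rule cSUP_upper2) simp
      also have "\<dots> \<le> \<epsilon> * norm (u - ub)"
      proof -
        have "Sup (?n ` \<Phi> u) / norm (u - ub) < \<epsilon>"
          using elim(2) \<open>u \<noteq> ub\<close> by simp
        then show ?thesis using \<open>u \<noteq> ub\<close> by (simp add: field_simps)
      qed
      finally show "?n A \<le> \<epsilon> * norm (u - ub)" .
    qed
  qed
qed

lemma norm_matrix_le_sum_rows: "norm A \<le> (\<Sum>i\<in>UNIV. norm (row i A))"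
  for A :: "real ^ 'n ^ 'm"
proof -
  have "row i A = A $ i" for i by (simp add: row_def vec_lambda_eta)
  then show ?thesis unfolding norm_vec_def[of A] using L2_set_le_sum[of UNIV "\<lambda>i. norm (A $ i)"] by simp
qed

section \<open>Semismoothness of the implicit function and of composites with it\<close>

text \<open>Row \<open>i\<close> of the matrix is treated by the first-order estimate with
  \<open>ys = axis i 1\<close>, a unit vector. It controls the \<open>i\<close>-th coordinate of the
  remainder, and the rows can be chosen independently for nonemptiness.\<close>

lemma semismooth_implicit_Psi:
  fixes F :: "((real ^ 'n) \<times> (real ^ 'm), real ^ 'l) multifunction"
  assumes "open \<Omega>" "x \<in> \<Omega>" and cont: "continuous_on \<Omega> \<sigma>"
    and zero: "\<And>u. u \<in> \<Omega> \<Longrightarrow> 0 \<in> F (u, \<sigma> u)"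
    and ss: "semismooth_star F (x, \<sigma> x) 0"
    and cq: "\<And>xs zs. (xs, 0) \<in> coderivative F (x, \<sigma> x) 0 zs \<Longrightarrow> zs = 0 \<and> xs = 0"
    and ne: "\<And>u ys. u \<in> \<Omega> \<Longrightarrow> implicit_coderivative F u (\<sigma> u) ys \<noteq> {}"
  shows "semismooth_wrt_at (*v) \<Omega> \<sigma> (implicit_Psi F \<Omega> \<sigma>) x"
proof -
  obtain K where "K > 0" and near: "\<forall>\<^sub>F u in nhds x. u \<in> \<Omega> \<and> norm (\<sigma> u - \<sigma> x) \<le> K * norm (u - x)
       \<and> (\<forall>ys. \<forall>xs \<in> implicit_coderivative F u (\<sigma> u) ys. norm xs \<le> K * norm ys)"
    and est: "\<And>\<epsilon>. \<epsilon> > 0 \<Longrightarrow> \<forall>\<^sub>F u in nhds x. \<forall>ys. \<forall>xs \<in> implicit_coderivative F u (\<sigma> u) ys.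
       \<bar>xs \<bullet> (u - x) - ys \<bullet> (\<sigma> u - \<sigma> x)\<bar> \<le> \<epsilon> * norm (u - x) * norm ys"
    by (rule implicit_coderivative_estimate[of \<Omega> x \<sigma> F]) (use assms in blast)+
  show ?thesis
  proof (rule semismooth_wrt_atI[OF \<open>open \<Omega>\<close> \<open>x \<in> \<Omega>\<close>])
    fix u assume "u \<in> \<Omega>"
    then have "\<forall>i. \<exists>xs. xs \<in> implicit_coderivative F u (\<sigma> u) (axis i 1)"
      using ne by (auto simp: ex_in_conv)
    then obtain g where "\<And>i. g i \<in> implicit_coderivative F u (\<sigma> u) (axis i 1)"
      by metis
    then have "(\<chi> i. g i) \<in> implicit_Psi F \<Omega> \<sigma> u"
      using \<open>u \<in> \<Omega>\<close> by (simp add: implicit_Psi_def row_def vec_lambda_eta)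
    then show "implicit_Psi F \<Omega> \<sigma> u \<noteq> {}" by blast
  next
    show "\<forall>\<^sub>F u in nhds x. \<forall>A \<in> implicit_Psi F \<Omega> \<sigma> u. norm A \<le> real CARD('m) * K"
      using near
    proof eventually_elim
      case (elim u)
      show ?case
      proof
        fix A assume "A \<in> implicit_Psi F \<Omega> \<sigma> u"
        then have "norm (row i A) \<le> K" for i
          using elim by (fastforce simp: implicit_Psi_def)
        then have "(\<Sum>i\<in>UNIV. norm (row i A)) \<le> real CARD('m) * K"
          by (intro sum_bounded_above)
        with norm_matrix_le_sum_rows[of A] show "norm A \<le> real CARD('m) * K" by linarith
      qed
    qed
  next
    fix \<epsilon> :: real assume "\<epsilon> > 0"
    \<comment> \<open>The Euclidean norm of the remainder is bounded by the sum of its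
      \<open>CARD('m)\<close> coordinates in absolute value.\<close>
    then have "\<epsilon> / real CARD('m) > 0" by simp
    from est[OF this] near
    show "\<forall>\<^sub>F u in nhds x. u \<noteq> x \<longrightarrow> (\<forall>A \<in> implicit_Psi F \<Omega> \<sigma> u.
        norm (\<sigma> u - \<sigma> x - A *v (u - x)) \<le> \<epsilon> * norm (u - x))"
    proof eventually_elim
      case (elim u)
      show ?case
      proof (intro impI ballI)
        fix A assume A: "A \<in> implicit_Psi F \<Omega> \<sigma> u"
        define d where "d = \<sigma> u - \<sigma> x - A *v (u - x)"
        have "\<bar>d $ i\<bar> \<le> \<epsilon> / real CARD('m) * norm (u - x)" for i
        proof -
          have "row i A \<in> implicit_coderivative F u (\<sigma> u) (axis i 1)"
            using A elim by (simp add: implicit_Psi_def)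
          then have "\<bar>row i A \<bullet> (u - x) - axis i 1 \<bullet> (\<sigma> u - \<sigma> x)\<bar>
              \<le> \<epsilon> / real CARD('m) * norm (u - x)"
            using elim(1) by fastforce
          moreover have "d $ i = axis i 1 \<bullet> (\<sigma> u - \<sigma> x) - row i A \<bullet> (u - x)"
            by (simp add: d_def matrix_vector_mul_component inner_axis' row_def vec_lambda_eta)
          ultimately show ?thesis by (simp add: abs_minus_commute)
        qed
        then have "(\<Sum>i\<in>UNIV. \<bar>d $ i\<bar>) \<le> real CARD('m) * (\<epsilon> / real CARD('m) * norm (u - x))"
          by (intro sum_bounded_above)
        then show "norm d \<le> \<epsilon> * norm (u - x)"
          using norm_le_l1_cart[of d] by simp
      qed
    qed
  qed
qed

text \<open>A chain rule: the remainder of the composite is the remainder of \<open>\<phi>\<close>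
  along the graph of \<open>\<sigma>\<close> for \<open>(gx, gy)\<close>, plus \<open>gy \<bullet>
  (\<sigma> u - \<sigma> x) - xs \<bullet> (u - x)\<close>, which the first-order estimate with
  \<open>ys = gy\<close> controls. Local boundedness of \<open>\<Phi>\<close> keeps
  \<open>gy\<close> bounded.\<close>

lemma semismooth_implicit_Theta:
  fixes F :: "((real ^ 'n) \<times> (real ^ 'm), real ^ 'l) multifunction"
  assumes "open \<Omega>" "x \<in> \<Omega>" and cont: "continuous_on \<Omega> \<sigma>"
    and zero: "\<And>u. u \<in> \<Omega> \<Longrightarrow> 0 \<in> F (u, \<sigma> u)"
    and ss: "semismooth_star F (x, \<sigma> x) 0"
    and cq: "\<And>xs zs. (xs, 0) \<in> coderivative F (x, \<sigma> x) 0 zs \<Longrightarrow> zs = 0 \<and> xs = 0"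
    and ne: "\<And>u ys. u \<in> \<Omega> \<Longrightarrow> implicit_coderivative F u (\<sigma> u) ys \<noteq> {}"
    and ne\<Phi>: "\<And>u. u \<in> \<Omega> \<Longrightarrow> \<Phi> (u, \<sigma> u) \<noteq> {}"
    and ss\<phi>: "semismooth_wrt_at (\<bullet>) D \<phi> \<Phi> (x, \<sigma> x)"
  shows "semismooth_wrt_at (\<bullet>) \<Omega> (\<lambda>u. \<phi> (u, \<sigma> u)) (implicit_Theta F \<Omega> \<sigma> \<Phi>) x"
proof -
  obtain K where "K > 0" and near: "\<forall>\<^sub>F u in nhds x. u \<in> \<Omega> \<and> norm (\<sigma> u - \<sigma> x) \<le> K * norm (u - x)
       \<and> (\<forall>ys. \<forall>xs \<in> implicit_coderivative F u (\<sigma> u) ys. norm xs \<le> K * norm ys)"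
    and est: "\<And>\<epsilon>. \<epsilon> > 0 \<Longrightarrow> \<forall>\<^sub>F u in nhds x. \<forall>ys. \<forall>xs \<in> implicit_coderivative F u (\<sigma> u) ys.
       \<bar>xs \<bullet> (u - x) - ys \<bullet> (\<sigma> u - \<sigma> x)\<bar> \<le> \<epsilon> * norm (u - x) * norm ys"
    by (rule implicit_coderivative_estimate[of \<Omega> x \<sigma> F]) (use assms in blast)+
  have "(\<sigma> \<longlongrightarrow> \<sigma> x) (nhds x)"
    using cont \<open>open \<Omega>\<close> \<open>x \<in> \<Omega>\<close>
    by (metis at_within_open continuous_on_def tendsto_at_iff_tendsto_nhds)
  then have pair: "((\<lambda>u. (u, \<sigma> u)) \<longlongrightarrow> (x, \<sigma> x)) (nhds x)"
    by (intro tendsto_Pair filterlim_ident)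
  obtain N where "open N" "(x, \<sigma> x) \<in> N" "bounded (\<Union>p\<in>N. \<Phi> p)"
    using ss\<phi> by (auto simp: semismooth_wrt_at_def)
  then obtain B where "B > 0" and B: "\<And>p g. p \<in> N \<Longrightarrow> g \<in> \<Phi> p \<Longrightarrow> norm g \<le> B"
    unfolding bounded_pos by blast
  have N: "\<forall>\<^sub>F u in nhds x. (u, \<sigma> u) \<in> N"
    using pair \<open>open N\<close> \<open>(x, \<sigma> x) \<in> N\<close> by (rule topological_tendstoD)
  have \<Phi>_bnd: "norm gx \<le> B \<and> norm gy \<le> B" if "(u, \<sigma> u) \<in> N" "(gx, gy) \<in> \<Phi> (u, \<sigma> u)" for u gx gy
    using B[OF that] norm_fst_le[of gx gy] norm_snd_le[of gy gx] by linarith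
  show ?thesis
  proof (rule semismooth_wrt_atI[OF \<open>open \<Omega>\<close> \<open>x \<in> \<Omega>\<close>])
    fix u assume "u \<in> \<Omega>"
    then obtain gx gy xs where "(gx, gy) \<in> \<Phi> (u, \<sigma> u)" "xs \<in> implicit_coderivative F u (\<sigma> u) gy"
      using ne ne\<Phi> by (metis all_not_in_conv prod.collapse)
    then show "implicit_Theta F \<Omega> \<sigma> \<Phi> u \<noteq> {}"
      using \<open>u \<in> \<Omega>\<close> by (auto simp: implicit_Theta_def)
  next
    show "\<forall>\<^sub>F u in nhds x. \<forall>A \<in> implicit_Theta F \<Omega> \<sigma> \<Phi> u. norm A \<le> B + K * B"
      using near N
    proof eventually_elim
      case (elim u)
      show ?case
      proof
        fix A assume "A \<in> implicit_Theta F \<Omega> \<sigma> \<Phi> u"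
        then obtain gx gy xs where A: "A = gx + xs" and g: "(gx, gy) \<in> \<Phi> (u, \<sigma> u)"
          and xs: "xs \<in> implicit_coderivative F u (\<sigma> u) gy"
          using elim by (auto simp: implicit_Theta_def)
        have "norm xs \<le> K * norm gy" using elim(1) xs by blast
        also have "\<dots> \<le> K * B" using \<Phi>_bnd[OF elim(2) g] \<open>K > 0\<close> by simp
        finally show "norm A \<le> B + K * B"
          using \<Phi>_bnd[OF elim(2) g] norm_triangle_ineq[of gx xs] by (simp add: A)
      qed
    qed
  next
    fix \<epsilon> :: real assume "\<epsilon> > 0"
    \<comment> \<open>The remainder of \<open>\<phi>\<close> contributes the factor
      \<open>1 + K\<close>, through calmness of \<open>\<sigma>\<close>, and the coderivative term
      contributes \<open>B\<close>, the bound on \<open>gy\<close>.\<close>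
    define \<eta> where "\<eta> = \<epsilon> / (1 + K + B)"
    have "\<eta> > 0" using \<open>\<epsilon> > 0\<close> \<open>K > 0\<close> \<open>B > 0\<close> by (simp add: \<eta>_def)
    have "\<forall>\<^sub>F u in nhds x. (u, \<sigma> u) \<noteq> (x, \<sigma> x) \<longrightarrow> (\<forall>g \<in> \<Phi> (u, \<sigma> u).
        norm (\<phi> (u, \<sigma> u) - \<phi> (x, \<sigma> x) - g \<bullet> ((u, \<sigma> u) - (x, \<sigma> x)))
          \<le> \<eta> * norm ((u, \<sigma> u) - (x, \<sigma> x)))"
      using eventually_compose_filterlim[OF semismooth_row_estimate[OF ss\<phi> \<open>\<eta> > 0\<close>] pair] .
    from this est[OF \<open>\<eta> > 0\<close>] near N
    show "\<forall>\<^sub>F u in nhds x. u \<noteq> x \<longrightarrow> (\<forall>A \<in> implicit_Theta F \<Omega> \<sigma> \<Phi> u.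
        norm (\<phi> (u, \<sigma> u) - \<phi> (x, \<sigma> x) - A \<bullet> (u - x)) \<le> \<epsilon> * norm (u - x))"
    proof eventually_elim
      case (elim u)
      show ?case
      proof (intro impI ballI)
        fix A assume "u \<noteq> x" and "A \<in> implicit_Theta F \<Omega> \<sigma> \<Phi> u"
        then obtain gx gy xs where A: "A = gx + xs" and g: "(gx, gy) \<in> \<Phi> (u, \<sigma> u)"
          and xs: "xs \<in> implicit_coderivative F u (\<sigma> u) gy"
          using elim by (auto simp: implicit_Theta_def)
        have "norm (\<phi> (u, \<sigma> u) - \<phi> (x, \<sigma> x) - (gx, gy) \<bullet> ((u, \<sigma> u) - (x, \<sigma> x)))
            \<le> \<eta> * norm ((u, \<sigma> u) - (x, \<sigma> x))"
          using elim(1) g \<open>u \<noteq> x\<close> by blast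
        also have "\<dots> \<le> \<eta> * ((1 + K) * norm (u - x))"
          using norm_Pair_le[of "u - x" "\<sigma> u - \<sigma> x"] elim(3) \<open>\<eta> > 0\<close>
          by (intro mult_left_mono) (auto simp: algebra_simps)
        finally have 1: "\<bar>\<phi> (u, \<sigma> u) - \<phi> (x, \<sigma> x) - gx \<bullet> (u - x) - gy \<bullet> (\<sigma> u - \<sigma> x)\<bar>
            \<le> \<eta> * ((1 + K) * norm (u - x))"
          by (simp add: algebra_simps)
        have "\<bar>xs \<bullet> (u - x) - gy \<bullet> (\<sigma> u - \<sigma> x)\<bar> \<le> \<eta> * norm (u - x) * norm gy"
          using elim(2) xs by blast
        also have "\<dots> \<le> \<eta> * norm (u - x) * B"
          using \<Phi>_bnd[OF elim(4) g] \<open>\<eta> > 0\<close> by (intro mult_left_mono) auto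
        finally have 2: "\<bar>xs \<bullet> (u - x) - gy \<bullet> (\<sigma> u - \<sigma> x)\<bar> \<le> \<eta> * norm (u - x) * B" .
        have "norm (\<phi> (u, \<sigma> u) - \<phi> (x, \<sigma> x) - A \<bullet> (u - x))
            \<le> \<eta> * ((1 + K) * norm (u - x)) + \<eta> * norm (u - x) * B"
          using 1 2 by (simp add: A inner_add_left)
        also have "\<dots> = \<eta> * (1 + K + B) * norm (u - x)" by (simp add: algebra_simps)
        also have "\<dots> = \<epsilon> * norm (u - x)"
          using \<open>K > 0\<close> \<open>B > 0\<close> by (simp add: \<eta>_def)
        finally show "norm (\<phi> (u, \<sigma> u) - \<phi> (x, \<sigma> x) - A \<bullet> (u - x)) \<le> \<epsilon> * norm (u - x)" .
      qed
    qed
  qed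
qed

theorem corollary5p5:
  fixes F :: "((real ^ 'n) \<times> (real ^ 'm), real ^ 'l) multifunction"
    and \<Omega> :: "(real ^ 'n) set"
    and \<sigma> :: "real ^ 'n \<Rightarrow> real ^ 'm"
  assumes "open \<Omega>"
    and "continuous_on \<Omega> \<sigma>"
    and "\<And>x. x \<in> \<Omega> \<Longrightarrow> locally_closed_at (gph F) ((x, \<sigma> x), 0)"
    and "\<And>x. x \<in> \<Omega> \<Longrightarrow> semismooth_star F (x, \<sigma> x) 0"
    and "\<And>x xs zs. x \<in> \<Omega> \<Longrightarrow> (xs, 0) \<in> coderivative F (x, \<sigma> x) 0 zs \<Longrightarrow> zs = 0 \<and> xs = 0"
    and "\<And>x. x \<in> \<Omega> \<Longrightarrow>
           \<exists>U V. open U \<and> open V \<and> x \<in> U \<and> \<sigma> x \<in> V \<and>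
                 gph (solution_map F) \<inter> (U \<times> V) = gph_on \<Omega> \<sigma> \<inter> (U \<times> V)"
  shows "semismooth_matrix_on \<Omega> \<sigma> (implicit_Psi F \<Omega> \<sigma>) \<Omega>
    \<and> (\<forall>(D :: ((real ^ 'n) \<times> (real ^ 'm)) set)
         (\<phi> :: (real ^ 'n) \<times> (real ^ 'm) \<Rightarrow> real)
         (\<Phi> :: ((real ^ 'n) \<times> (real ^ 'm), (real ^ 'n) \<times> (real ^ 'm)) multifunction).
         open D \<and> gph_on \<Omega> \<sigma> \<subseteq> D \<and> semismooth_row_on D \<phi> \<Phi> (gph_on \<Omega> \<sigma>) \<longrightarrow>
         semismooth_row_on \<Omega> (\<lambda>x. \<phi> (x, \<sigma> x)) (implicit_Theta F \<Omega> \<sigma> \<Phi>) \<Omega>)"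
proof -
  note cq = assms(5)
  \<comment> \<open>Membership of the base point in the graph is part of semismoothness*.\<close>
  have zero: "0 \<in> F (u, \<sigma> u)" if "u \<in> \<Omega>" for u
    using assms(4)[OF that] by (simp add: semismooth_star_def gph_def)
  have ne: "implicit_coderivative F u (\<sigma> u) ys \<noteq> {}" if u: "u \<in> \<Omega>" for u ys
  proof -
    obtain U V where UV: "open U" "open V" "u \<in> U" "\<sigma> u \<in> V"
      "gph (solution_map F) \<inter> (U \<times> V) = gph_on \<Omega> \<sigma> \<inter> (U \<times> V)"
      using assms(6)[OF u] by blast
    \<comment> \<open>The local equality of graphs, read on the slice over \<open>u\<close>,
      isolates \<open>\<sigma> u\<close> among the solutions at \<open>u\<close>.\<close>
    have "y = \<sigma> u" if "y \<in> V" "0 \<in> F (u, y)" for y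
    proof -
      have "(u, y) \<in> gph (solution_map F) \<inter> (U \<times> V)"
        using that \<open>u \<in> U\<close> by (simp add: gph_def solution_map_def)
      then have "(u, y) \<in> gph_on \<Omega> \<sigma>" using UV(5) by blast
      then show ?thesis by (auto simp: gph_on_def)
    qed
    then show ?thesis
      using implicit_coderivative_nonempty[OF zero[OF u] assms(3)[OF u] _ UV(2,4)] cq[OF u] by blast
  qed
  show ?thesis
  proof (intro conjI allI impI)
    show "semismooth_matrix_on \<Omega> \<sigma> (implicit_Psi F \<Omega> \<sigma>) \<Omega>"
      unfolding semismooth_matrix_on_def
      by (intro ballI semismooth_implicit_Psi) (use assms zero ne in blast)+
  next
    fix D \<phi> and \<Phi> :: "((real ^ 'n) \<times> (real ^ 'm), (real ^ 'n) \<times> (real ^ 'm)) multifunction"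
    assume "open D \<and> gph_on \<Omega> \<sigma> \<subseteq> D \<and> semismooth_row_on D \<phi> \<Phi> (gph_on \<Omega> \<sigma>)"
    then have ss\<phi>: "semismooth_wrt_at (\<bullet>) D \<phi> \<Phi> (u, \<sigma> u)" if "u \<in> \<Omega>" for u
      using that by (auto simp: semismooth_row_on_def gph_on_def)
    \<comment> \<open>Semismoothness of \<open>\<phi>\<close> at the graph point places that point
      in the interior of the domain of \<open>\<Phi>\<close>.\<close>
    have ne\<Phi>: "\<Phi> (u, \<sigma> u) \<noteq> {}" if "u \<in> \<Omega>" for u
      using ss\<phi>[OF that] interior_subset by (auto simp: semismooth_wrt_at_def mdom_def)
    show "semismooth_row_on \<Omega> (\<lambda>x. \<phi> (x, \<sigma> x)) (implicit_Theta F \<Omega> \<sigma> \<Phi>) \<Omega>"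
      unfolding semismooth_row_on_def
      by (intro ballI semismooth_implicit_Theta) (use assms zero ne ne\<Phi> ss\<phi> in blast)+
  qed
qed

end
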